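(* Let $(E,\pi,B)$ be a real vector bundle with $n$-dimensional fibres and let $g$ be a real bundle metric on it whose signature does not depend on the point $\gamma(s)$ at which it is evaluated, for every (resp. some) path $\gamma:J\to B$. Let bases $\{e_i(s)\}$, $s\in J$, be chosen along $\gamma$ in such a way that the first $p$ eigenvalues of the matrix $G(\gamma(s))$ defining the metric in them are positive ($p$ being the number of positive eigenvalues and $q=n-p$ the number of negative ones). Then a linear transport along paths is consistent with $g$ along every (resp. the given) path $\gamma$ if and only if some of the matrix functions $F$ defining its matrix $H(t,s;\gamma)=F^{-1}(t;\gamma)F(s;\gamma)$ has the form $$F(s;\gamma)=Y(\gamma)Z(s;\gamma)\bigl(D(\gamma(s))\bigr)^{-1},\qquad s\in J,$$ for every (resp. the given) path $\gamma$. Here $Y(\gamma)$ is a nondegenerate $n\times n$ matrix function of $\gamma$; $Z(s;\gamma)$ is a pseudo-orthogonal matrix of type $(p,q)$, i.e. $Z(s;\gamma)\in O(p,q)$, or $$\bigl(Z(s;\gamma)\bigr)^{T}G_{p,q}Z(s;\gamma)=G_{p,q}:=\mathrm{diag}(\underbrace{1,\dots,1}_{p},\underbrace{-1,\dots,-1}_{q});$$ and $D(\gamma(s))$ is a fixed (orthogonal) matrix such that $$\bigl(D(\gamma(s))\bigr)^{T}G(\gamma(s))D(\gamma(s))=G_{p,q}.$$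
   Context: Paths in $B$ are denoted $\gamma:J\to B$, with $J$ an arbitrary real interval. A real bundle metric $g$ assigns to each $x\in B$ a bilinear, symmetric, nondegenerate map $g_x:\pi^{-1}(x)\times\pi^{-1}(x)\to\mathbb{R}$. Its signature at $x$ is $p(x)-q(x)$, with $p(x)$ and $q(x)=n-p(x)$ the numbers of positive and negative eigenvalues of the matrix of $g_x$ in a basis of $\pi^{-1}(x)$. A linear transport along paths $L$ assigns to each path $\gamma:J\to B$ and $s,t\in J$ a linear map $L^\gamma_{s\to t}:\pi^{-1}(\gamma(s))\to\pi^{-1}(\gamma(t))$ with $L^\gamma_{t\to r}\circ L^\gamma_{s\to t}=L^\gamma_{s\to r}$ and $L^\gamma_{s\to s}=\mathrm{id}$ for all $r,s,t\in J$. $L$ and $g$ are consistent along $\gamma$ if $g_{\gamma(s)}(u,v)=g_{\gamma(t)}(L^\gamma_{s\to t}u,L^\gamma_{s\to t}v)$ for all $s,t\in J$ and $u,v\in\pi^{-1}(\gamma(s))$. Matrices: in bases $\{e_i(s)\}$ of $\pi^{-1}(\gamma(s))$, $H(t,s;\gamma)=[H^{i}_{\;j}(t,s;\gamma)]$ is defined by $L^\gamma_{s\to t}e_j(s)=\sum_i H^{i}_{\;j}(t,s;\gamma)e_i(t)$, and $G(\gamma(s))=[g_{\gamma(s)}(e_i(s),e_j(s))]_{ij}$. Every linear transport has a matrix of the form $H(t,s;\gamma)=F^{-1}(t;\gamma)F(s;\gamma)$ with $F(s;\gamma)$ nondegenerate, $F$ being defined up to $F(s;\gamma)\mapsto A(\gamma)F(s;\gamma)$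 with $A(\gamma)$ nondegenerate. $T$ denotes matrix transposition.
   Formalization: The parenthetical requirement that D be orthogonal is dropped, since an orthogonal D with D^T G D = G_{p,q} need not exist (n=1, G=(2)); existence is proved for nondegenerate D, and the equivalence for every D satisfying the displayed equation. *)

theory Defs
  imports
    "HOL-Analysis.Abstract_Euclidean_Space"
    "Jordan_Normal_Form.VS_Connect"
    "Jordan_Normal_Form.Char_Poly"
    "Jordan_Normal_Form.Gauss_Jordan_Elimination"
begin

section \<open>Real vector bundles\<close>

text \<open>The total space and the base are topologies on carrier sets, and each fibre is a vector
  space in the sense of \<open>vectorspace\<close> over the field of reals (\<open>class_ring\<close>).\<close>

record ('e, 'b) vbundle =
  total_space :: "'e topology"
  base_space :: "'b topology"
  projection :: "'e \<Rightarrow> 'b"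
  fibre :: "'b \<Rightarrow> (real, 'e) module"

text \<open>A local trivialization over \<open>U\<close>: a homeomorphism of the part of the total space over \<open>U\<close>
  with the product of \<open>U\<close> and real \<open>n\<close>-space, over the identity of \<open>U\<close> and linear on the fibres.\<close>

definition local_trivialization ::
    "nat \<Rightarrow> ('e, 'b) vbundle \<Rightarrow> 'b set \<Rightarrow> ('e \<Rightarrow> 'b \<times> (nat \<Rightarrow> real)) \<Rightarrow> bool" where
  "local_trivialization n E U \<phi> \<longleftrightarrow>
     homeomorphic_map
       (subtopology (total_space E) {v \<in> topspace (total_space E). projection E v \<in> U})
       (prod_topology (subtopology (base_space E) U) (Euclidean_space n)) \<phi> \<and>
     (\<forall>v \<in> topspace (total_space E). projection E v \<in> U \<longrightarrow> fst (\<phi> v) = projection E v) \<and>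
     (\<forall>x \<in> U. \<forall>u \<in> carrier (fibre E x). \<forall>v \<in> carrier (fibre E x). \<forall>a b. \<forall>i<n.
        snd (\<phi> ((a \<odot>\<^bsub>fibre E x\<^esub> u) \<oplus>\<^bsub>fibre E x\<^esub> (b \<odot>\<^bsub>fibre E x\<^esub> v))) i
          = a * snd (\<phi> u) i + b * snd (\<phi> v) i)"

definition real_vector_bundle :: "nat \<Rightarrow> ('e, 'b) vbundle \<Rightarrow> bool" where
  "real_vector_bundle n E \<longleftrightarrow>
     continuous_map (total_space E) (base_space E) (projection E) \<and>
     (\<forall>x \<in> topspace (base_space E).
        carrier (fibre E x) = {v \<in> topspace (total_space E). projection E v = x} \<and>
        vectorspace class_ring (fibre E x) \<and>
        vectorspace.fin_dim class_ring (fibre E x) \<and>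
        vectorspace.dim class_ring (fibre E x) = n) \<and>
     (\<forall>x \<in> topspace (base_space E). \<exists>U \<phi>.
        openin (base_space E) U \<and> x \<in> U \<and> local_trivialization n E U \<phi>)"

definition fibre_basis :: "nat \<Rightarrow> ('e, 'b) vbundle \<Rightarrow> 'b \<Rightarrow> (nat \<Rightarrow> 'e) \<Rightarrow> bool" where
  "fibre_basis n E x b \<longleftrightarrow>
     inj_on b {..<n} \<and> vectorspace.basis class_ring (fibre E x) (b ` {..<n})"


section \<open>Bundle metrics\<close>

definition bundle_metric :: "('e, 'b) vbundle \<Rightarrow> ('b \<Rightarrow> 'e \<Rightarrow> 'e \<Rightarrow> real) \<Rightarrow> bool" where
  "bundle_metric E g \<longleftrightarrow> (\<forall>x \<in> topspace (base_space E).
     (\<forall>u \<in> carrier (fibre E x). \<forall>v \<in> carrier (fibre E x). \<forall>w \<in> carrier (fibre E x). \<forall>a b.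
        g x ((a \<odot>\<^bsub>fibre E x\<^esub> u) \<oplus>\<^bsub>fibre E x\<^esub> (b \<odot>\<^bsub>fibre E x\<^esub> v)) w = a * g x u w + b * g x v w \<and>
        g x w ((a \<odot>\<^bsub>fibre E x\<^esub> u) \<oplus>\<^bsub>fibre E x\<^esub> (b \<odot>\<^bsub>fibre E x\<^esub> v)) = a * g x w u + b * g x w v) \<and>
     (\<forall>u \<in> carrier (fibre E x). \<forall>v \<in> carrier (fibre E x). g x u v = g x v u) \<and>
     (\<forall>u \<in> carrier (fibre E x).
        (\<forall>v \<in> carrier (fibre E x). g x u v = 0) \<longrightarrow> u = \<zero>\<^bsub>fibre E x\<^esub>))"

definition metric_matrix :: "nat \<Rightarrow> ('b \<Rightarrow> 'e \<Rightarrow> 'e \<Rightarrow> real) \<Rightarrow> 'b \<Rightarrow> (nat \<Rightarrow> 'e) \<Rightarrow> real mat" where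
  "metric_matrix n g x b = mat n n (\<lambda>(i, j). g x (b i) (b j))"

text \<open>Eigenvalues are the roots of the characteristic polynomial, counted with multiplicity.\<close>

definition eigenvalues_mset :: "real mat \<Rightarrow> real multiset" where
  "eigenvalues_mset A = proots (char_poly A)"

definition num_pos_eigenvalues :: "real mat \<Rightarrow> nat" where
  "num_pos_eigenvalues A = size (filter_mset (\<lambda>x. 0 < x) (eigenvalues_mset A))"

definition num_neg_eigenvalues :: "real mat \<Rightarrow> nat" where
  "num_neg_eigenvalues A = size (filter_mset (\<lambda>x. x < 0) (eigenvalues_mset A))"

text \<open>By Sylvester's law of inertia the choice of the basis is irrelevant here.\<close>

definition signature_at ::
    "nat \<Rightarrow> ('e, 'b) vbundle \<Rightarrow> ('b \<Rightarrow> 'e \<Rightarrow> 'e \<Rightarrow> real) \<Rightarrow> 'b \<Rightarrow> int" where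
  "signature_at n E g x =
     (let G = metric_matrix n g x (SOME b. fibre_basis n E x b)
      in int (num_pos_eigenvalues G) - int (num_neg_eigenvalues G))"

text \<open>A matrix does not order its eigenvalues; ``the first \<open>p\<close> eigenvalues are positive'' refers
  to an enumeration \<open>xs\<close> of them.\<close>

definition first_eigenvalues_pos :: "nat \<Rightarrow> real mat \<Rightarrow> bool" where
  "first_eigenvalues_pos p A \<longleftrightarrow> (\<exists>xs. mset xs = eigenvalues_mset A \<and> (\<forall>i<p. 0 < xs ! i))"


section \<open>Paths and linear transports\<close>

text \<open>A path is a continuous map on a nonempty real interval of any kind. It is a pair of its
  domain and a function that is \<open>undefined\<close> outside the domain, so that two paths are equal
  exactly if they have the same domain and the same values on it.\<close>

type_synonym 'b bpath = "real set \<times> (real \<Rightarrow> 'b)"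

abbreviation dom_of :: "'b bpath \<Rightarrow> real set" where
  "dom_of \<equiv> fst"

abbreviation point_at :: "'b bpath \<Rightarrow> real \<Rightarrow> 'b" where
  "point_at \<equiv> snd"

definition paths_in :: "'b topology \<Rightarrow> 'b bpath set" where
  "paths_in B = {(J, \<gamma>). is_interval J \<and> J \<noteq> {} \<and> \<gamma> \<in> extensional J \<and>
     continuous_map (top_of_set J) B \<gamma>}"

text \<open>\<open>L \<gamma> s t\<close> is the transport along \<open>\<gamma>\<close> from \<open>s\<close> to \<open>t\<close>.\<close>

definition linear_transport ::
    "('e, 'b) vbundle \<Rightarrow> ('b bpath \<Rightarrow> real \<Rightarrow> real \<Rightarrow> 'e \<Rightarrow> 'e) \<Rightarrow> bool" where
  "linear_transport E L \<longleftrightarrow> (\<forall>\<gamma> \<in> paths_in (base_space E).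
     (\<forall>s \<in> dom_of \<gamma>. \<forall>t \<in> dom_of \<gamma>.
        linear_map class_ring (fibre E (point_at \<gamma> s)) (fibre E (point_at \<gamma> t)) (L \<gamma> s t)) \<and>
     (\<forall>r \<in> dom_of \<gamma>. \<forall>s \<in> dom_of \<gamma>. \<forall>t \<in> dom_of \<gamma>. \<forall>u \<in> carrier (fibre E (point_at \<gamma> s)).
        L \<gamma> t r (L \<gamma> s t u) = L \<gamma> s r u) \<and>
     (\<forall>s \<in> dom_of \<gamma>. \<forall>u \<in> carrier (fibre E (point_at \<gamma> s)). L \<gamma> s s u = u))"

definition consistent_along ::
    "('e, 'b) vbundle \<Rightarrow> ('b \<Rightarrow> 'e \<Rightarrow> 'e \<Rightarrow> real) \<Rightarrow> ('b bpath \<Rightarrow> real \<Rightarrow> real \<Rightarrow> 'e \<Rightarrow> 'e)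
       \<Rightarrow> 'b bpath \<Rightarrow> bool" where
  "consistent_along E g L \<gamma> \<longleftrightarrow>
     (\<forall>s \<in> dom_of \<gamma>. \<forall>t \<in> dom_of \<gamma>.
        \<forall>u \<in> carrier (fibre E (point_at \<gamma> s)). \<forall>v \<in> carrier (fibre E (point_at \<gamma> s)).
        g (point_at \<gamma> s) u v = g (point_at \<gamma> t) (L \<gamma> s t u) (L \<gamma> s t v))"

text \<open>\<open>M\<close> is the matrix of the linear map \<open>T\<close> into the space \<open>W\<close>, with respect to the basis \<open>b\<close> of
  its domain and the basis \<open>b'\<close> of \<open>W\<close>.\<close>

definition matrix_of_map ::
    "nat \<Rightarrow> (real, 'e) module \<Rightarrow> (nat \<Rightarrow> 'e) \<Rightarrow> (nat \<Rightarrow> 'e) \<Rightarrow> ('e \<Rightarrow> 'e) \<Rightarrow> real mat \<Rightarrow> bool" where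
  "matrix_of_map n W b b' T M \<longleftrightarrow> M \<in> carrier_mat n n \<and>
     (\<forall>j<n. T (b j) = (\<Oplus>\<^bsub>W\<^esub> i \<in> {..<n}. (M $$ (i, j)) \<odot>\<^bsub>W\<^esub> b' i))"


section \<open>Matrices\<close>

definition nondegenerate_mats :: "nat \<Rightarrow> real mat set" where
  "nondegenerate_mats n = {A \<in> carrier_mat n n. invertible_mat A}"

text \<open>The library's inverse is an option, which is \<open>Some\<close> for nondegenerate matrices.\<close>

abbreviation mat_inv :: "real mat \<Rightarrow> real mat" where
  "mat_inv A \<equiv> the (mat_inverse A)"

definition G_pq :: "nat \<Rightarrow> nat \<Rightarrow> real mat" where
  "G_pq p q = mat_diag (p + q) (\<lambda>i. if i < p then 1 else - 1)"

definition pseudo_orthogonal :: "nat \<Rightarrow> nat \<Rightarrow> real mat set" where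
  "pseudo_orthogonal p q =
     {Z \<in> carrier_mat (p + q) (p + q). transpose_mat Z * G_pq p q * Z = G_pq p q}"

end

theory Submission
  imports Defs
begin

text \<open>In the given bases, consistency of the transport with the metric along a path means
  \<open>H(t,s)\<^sup>T G(t) H(t,s) = G(s)\<close>. A matrix \<open>D\<close> with \<open>D\<^sup>T G D = G_pq\<close> is obtained from an
  orthonormal eigenbasis of \<open>G\<close> by rescaling; here the assumption on the numbers of eigenvalues
  guarantees that the characteristic polynomial splits over the reals. If
  \<open>F = Y Z D\<^sup>-\<^sup>1\<close>, then \<open>X = Z D\<^sup>-\<^sup>1\<close> satisfies \<open>X(t) H(t,s) = X(s)\<close> and \<open>X\<^sup>T G_pq X = G\<close>,
  hence consistency. Conversely, fix a parameter \<open>s\<^sub>0\<close> on the path and take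
  \<open>F(s) = D(s\<^sub>0)\<^sup>-\<^sup>1 H(s\<^sub>0,s)\<close>, \<open>Y = 1\<close> and \<open>Z = F D\<close>.\<close>


section \<open>Congruence of matrices\<close>

lemma congruence_mult:
  fixes A B M :: "'a :: comm_semiring_0 mat"
  assumes "A \<in> carrier_mat n n" "B \<in> carrier_mat n n" "M \<in> carrier_mat n n"
  shows "transpose_mat (A * B) * M * (A * B) = transpose_mat B * (transpose_mat A * M * A) * B"
proof -
  note [simp] = mult_carrier_mat[of _ n n _ n] assoc_mult_mat[of _ n n _ n _ n]
    transpose_mult[of _ n n _ n]
  show ?thesis using assms by simp
qed

lemma congruence_cancel:
  fixes M D :: "'a :: comm_semiring_1 mat"
  assumes "D \<in> carrier_mat n n" "D' \<in> carrier_mat n n" "M \<in> carrier_mat n n"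
    and "D * D' = 1\<^sub>m n"
  shows "transpose_mat D' * (transpose_mat D * M * D) * D' = M"
proof -
  have "transpose_mat D' * (transpose_mat D * M * D) * D' = transpose_mat (D * D') * M * (D * D')"
    using assms(1-3) by (intro congruence_mult[symmetric]) auto
  thus ?thesis using assms(3,4) by simp
qed

text \<open>The determinant of a congruence is a product of three determinants. Thus nondegeneracy
  of \<open>G_pq\<close> passes to \<open>D\<close> and \<open>G\<close>, and from \<open>G\<close>
  to \<open>F\<close>.\<close>

lemma det_nonzero_of_congruence:
  fixes D M :: "'a :: idom mat"
  assumes "D \<in> carrier_mat n n" "M \<in> carrier_mat n n"
    and "det (transpose_mat D * M * D) \<noteq> 0"
  shows "det D \<noteq> 0" "det M \<noteq> 0"
proof -
  have "det (transpose_mat D * M * D) = det (transpose_mat D) * det M * det D"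
    using assms(1,2) by (simp add: det_mult[of _ n] mult_carrier_mat[of _ n n _ n])
  thus "det D \<noteq> 0" "det M \<noteq> 0" using assms(3) by auto
qed

section \<open>Inverses and nondegenerate matrices\<close>

lemma mat_inv_props:
  assumes A: "A \<in> carrier_mat n n" and "det A \<noteq> 0"
  shows "A * mat_inv A = 1\<^sub>m n" "mat_inv A * A = 1\<^sub>m n" "mat_inv A \<in> carrier_mat n n"
proof -
  have "A \<in> Units (ring_mat TYPE(real) n ())"
    using assms by (rule det_non_zero_imp_unit)
  then obtain B where "mat_inverse A = Some B"
    using mat_inverse(1)[OF A, where b = "()"] by (cases "mat_inverse A") auto
  thus "A * mat_inv A = 1\<^sub>m n" "mat_inv A * A = 1\<^sub>m n" "mat_inv A \<in> carrier_mat n n"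
    using mat_inverse(2)[OF A] by auto
qed

lemma nondegenerate_mats_iff:
  "A \<in> nondegenerate_mats n \<longleftrightarrow> A \<in> carrier_mat n n \<and> det A \<noteq> 0"
proof (intro iffI conjI)
  assume "A \<in> nondegenerate_mats n"
  then obtain B where A: "A \<in> carrier_mat n n"
    and B: "A * B = 1\<^sub>m n" "B * A = 1\<^sub>m (dim_row B)"
    unfolding nondegenerate_mats_def invertible_mat_def inverts_mat_def by auto
  \<comment> \<open>\<open>invertible_mat\<close> does not fix the shape of \<open>B\<close>; the
    column count comes from \<open>A * B\<close> and the row count from
    \<open>B * A\<close>.\<close>
  have "dim_row B = n" "dim_col B = n"
    using A B by (metis carrier_matD(2) index_mult_mat(3) index_one_mat(3))+
  hence "det A * det B = 1"
    using A B(1) det_mult[of A n B] by (metis carrier_matI det_one)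
  thus "A \<in> carrier_mat n n" "det A \<noteq> 0" using A by auto
next
  assume A: "A \<in> carrier_mat n n \<and> det A \<noteq> 0"
  hence "inverts_mat A (mat_inv A)" "inverts_mat (mat_inv A) A"
    using mat_inv_props[of A n] unfolding inverts_mat_def by auto
  thus "A \<in> nondegenerate_mats n"
    using A unfolding nondegenerate_mats_def invertible_mat_def by auto
qed

section \<open>The form \<open>G_pq\<close> and factorizations of transport matrices\<close>

lemma G_pq_carrier: "G_pq p q \<in> carrier_mat (p + q) (p + q)"
  by (simp add: G_pq_def)

lemma det_G_pq_nonzero: "det (G_pq p q) \<noteq> 0"
proof -
  \<comment> \<open>Every diagonal entry squares to 1, so \<open>G_pq\<close> is its own inverse and
    its determinant squares to 1.\<close>
  have "G_pq p q * G_pq p q = mat_diag (p + q) (\<lambda>i. (if i < p then 1 else - 1) * (if i < p then 1 else - 1))"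
    unfolding G_pq_def by simp
  also have "(\<lambda>i. (if i < p then 1 else - 1) * (if i < p then 1 else - 1)) = (\<lambda>i. 1 :: real)"
    by auto
  finally have "det (G_pq p q) * det (G_pq p q) = 1"
    using det_mult[OF G_pq_carrier G_pq_carrier, of p q] by simp
  thus ?thesis by auto
qed

text \<open>The sufficient direction for one pair of parameters, with \<open>K\<close> in the place
  of \<open>G_pq\<close>. The left factor \<open>Y\<close> is common to \<open>F t\<close> and
  \<open>F s\<close> and cancels from \<open>F t * H = F s\<close>; what remains relates two
  matrices that pull \<open>K\<close> back to the metric.\<close>

lemma transport_factorization_imp_isometry:
  assumes D: "D t \<in> carrier_mat n n" "D s \<in> carrier_mat n n"
    and G: "G t \<in> carrier_mat n n" "G s \<in> carrier_mat n n"
    and DG: "transpose_mat (D t) * G t * D t = K" "transpose_mat (D s) * G s * D s = K"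
    and K: "K \<in> carrier_mat n n" "det K \<noteq> 0"
    and F: "F t \<in> nondegenerate_mats n" "F s \<in> nondegenerate_mats n"
    and H: "H = mat_inv (F t) * F s"
    and Y: "Y \<in> nondegenerate_mats n"
    and Z: "Z t \<in> carrier_mat n n" "Z s \<in> carrier_mat n n"
      "transpose_mat (Z t) * K * Z t = K" "transpose_mat (Z s) * K * Z s = K"
    and FZ: "F t = Y * Z t * mat_inv (D t)" "F s = Y * Z s * mat_inv (D s)"
  shows "transpose_mat H * G t * H = G s"
proof -
  note [simp] = mult_carrier_mat[of _ n n _ n] assoc_mult_mat[of _ n n _ n _ n]
  define X where "X r = Z r * mat_inv (D r)" for r
  have dD: "det (D t) \<noteq> 0" "det (D s) \<noteq> 0"
    using det_nonzero_of_congruence D G DG K by metis+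
  note Dt = mat_inv_props[OF D(1) dD(1)] and Ds = mat_inv_props[OF D(2) dD(2)]
  have X: "X t \<in> carrier_mat n n" "X s \<in> carrier_mat n n"
    unfolding X_def using Dt Ds Z by auto
  \<comment> \<open>\<open>Z r\<close> preserves \<open>K\<close>, and congruence by
    \<open>mat_inv (D r)\<close> undoes \<open>D\<^sup>T G D = K\<close>; the product
    \<open>X r\<close> therefore brings \<open>K\<close> to \<open>G r\<close>.\<close>
  have XK: "transpose_mat (X t) * K * X t = G t" "transpose_mat (X s) * K * X s = G s"
    unfolding X_def
    using congruence_mult[OF Z(1) Dt(3) K(1)] congruence_mult[OF Z(2) Ds(3) K(1)]
      congruence_cancel[OF D(1) Dt(3) G(1) Dt(1)] congruence_cancel[OF D(2) Ds(3) G(2) Ds(1)]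
      DG Z(3,4) by simp_all
  have Fc: "F t \<in> carrier_mat n n" "det (F t) \<noteq> 0" "F s \<in> carrier_mat n n"
    and Yc: "Y \<in> carrier_mat n n" "det Y \<noteq> 0"
    using F Y nondegenerate_mats_iff by auto
  note Ft = mat_inv_props[OF Fc(1,2)] and Yi = mat_inv_props[OF Yc]
  have Hc: "H \<in> carrier_mat n n" using H Ft Fc by auto
  have FX: "F t = Y * X t" "F s = Y * X s"
    unfolding FZ X_def using Yc Z Dt(3) Ds(3) by auto
  have "F t * H = (F t * mat_inv (F t)) * F s" unfolding H using Ft(3) Fc by simp
  hence "F t * H = F s" using Ft(1) Fc by simp
  hence "mat_inv Y * (Y * X t * H) = mat_inv Y * (Y * X s)" using FX by simp
  hence "(mat_inv Y * Y) * (X t * H) = (mat_inv Y * Y) * X s" using X Hc Yc Yi(3) by simp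
  hence XH: "X t * H = X s" using Yi(2) X Hc by simp
  show ?thesis
    using congruence_mult[OF X(1) Hc K(1)] XH XK by simp
qed

text \<open>The necessary direction: \<open>F s\<close> transports to the base point
  \<open>s0\<close> and there passes to coordinates in which the metric is \<open>K\<close>. As
  transport preserves the metric, \<open>F s\<close> pulls \<open>K\<close> back to
  \<open>G s\<close>, and \<open>D s\<close> then returns \<open>K\<close>, so that
  \<open>Z s\<close> preserves \<open>K\<close>.\<close>

lemma isometry_imp_transport_factorization:
  assumes s0: "s0 \<in> J"
    and D: "\<And>s. s \<in> J \<Longrightarrow> D s \<in> carrier_mat n n"
    and G: "\<And>s. s \<in> J \<Longrightarrow> G s \<in> carrier_mat n n"
    and H: "\<And>s t. s \<in> J \<Longrightarrow> t \<in> J \<Longrightarrow> H t s \<in> carrier_mat n n"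
    and DG: "\<And>s. s \<in> J \<Longrightarrow> transpose_mat (D s) * G s * D s = K"
    and K: "K \<in> carrier_mat n n" "det K \<noteq> 0"
    and HH: "\<And>r s t. r \<in> J \<Longrightarrow> s \<in> J \<Longrightarrow> t \<in> J \<Longrightarrow> H r t * H t s = H r s"
    and HG: "\<And>s t. s \<in> J \<Longrightarrow> t \<in> J \<Longrightarrow> transpose_mat (H t s) * G t * H t s = G s"
  defines "F \<equiv> \<lambda>s. mat_inv (D s0) * H s0 s"
  defines "Z \<equiv> \<lambda>s. F s * D s"
  shows "s \<in> J \<Longrightarrow> F s \<in> nondegenerate_mats n"
    and "s \<in> J \<Longrightarrow> t \<in> J \<Longrightarrow> H t s = mat_inv (F t) * F s"
    and "s \<in> J \<Longrightarrow> Z s \<in> carrier_mat n n"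
    and "s \<in> J \<Longrightarrow> transpose_mat (Z s) * K * Z s = K"
    and "s \<in> J \<Longrightarrow> F s = 1\<^sub>m n * Z s * mat_inv (D s)"
proof -
  note [simp] = mult_carrier_mat[of _ n n _ n] assoc_mult_mat[of _ n n _ n _ n]
  have dD: "det (D s) \<noteq> 0" and dG: "det (G s) \<noteq> 0" if "s \<in> J" for s
    using det_nonzero_of_congruence D G DG K that by metis+
  note Di = mat_inv_props[OF D dD]
  have Fc: "F s \<in> carrier_mat n n" if "s \<in> J" for s
    using that Di s0 H by (simp add: F_def)
  have FK: "transpose_mat (F s) * K * F s = G s" if s: "s \<in> J" for s
    using congruence_mult[OF Di(3)[OF s0 s0] H[OF s s0] K(1)]
      congruence_cancel[OF D[OF s0] Di(3)[OF s0 s0] G[OF s0] Di(1)[OF s0 s0]] DG[OF s0] HG[OF s s0]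
    by (simp add: F_def)
  \<comment> \<open>Read off from \<open>FK\<close>, whose right-hand side \<open>G s\<close> has
    nonzero determinant.\<close>
  have dF: "det (F s) \<noteq> 0" if s: "s \<in> J" for s
    using det_nonzero_of_congruence(1)[OF Fc K(1)] FK dG s by metis
  note Fi = mat_inv_props[OF Fc dF]
  show "F s \<in> nondegenerate_mats n" if "s \<in> J" for s
    using that Fc dF by (simp add: nondegenerate_mats_iff)
  show "H t s = mat_inv (F t) * F s" if st: "s \<in> J" "t \<in> J" for s t
  proof -
    \<comment> \<open>The composition law through \<open>t\<close>:
      \<open>H s0 s = H s0 t * H t s\<close>.\<close>
    have "F s = F t * H t s" using HH[OF s0 st] H st s0 Di(3)[OF s0 s0] by (simp add: F_def)
    hence "mat_inv (F t) * F s = (mat_inv (F t) * F t) * H t s" using Fi(3) Fc H st by simp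
    thus ?thesis using Fi(2) H[OF st] st by simp
  qed
  show "Z s \<in> carrier_mat n n" if "s \<in> J" for s using that Fc D by (simp add: Z_def)
  show "transpose_mat (Z s) * K * Z s = K" if s: "s \<in> J" for s
    using congruence_mult[OF Fc[OF s] D[OF s] K(1)] FK[OF s] DG[OF s] by (simp add: Z_def)
  show "F s = 1\<^sub>m n * Z s * mat_inv (D s)" if s: "s \<in> J" for s
    using Fc[OF s] D[OF s] Di[OF s s] by (simp add: Z_def)
qed


section \<open>Orthogonal diagonalization\<close>

text \<open>The reflection exchanging \<open>v\<close> and the first unit vector; if they are equal, then \<open>S = 0\<close>
  and \<open>c = 2 / 0 = 0\<close>, so that \<open>W\<close> is the identity.\<close>

lemma householder:
  fixes v :: "real vec"
  assumes v: "v \<in> carrier_vec (Suc n)" and vv: "v \<bullet> v = 1"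
  obtains W where "W \<in> carrier_mat (Suc n) (Suc n)" "transpose_mat W * W = 1\<^sub>m (Suc n)"
    "col W 0 = v"
proof -
  \<comment> \<open>\<open>w\<close> is the first unit vector minus \<open>v\<close> and
    \<open>S\<close> its squared length; for \<open>S \<noteq> 0\<close>, \<open>W\<close> is the
    reflection in the hyperplane orthogonal to \<open>w\<close>.\<close>
  define w where "w i = (if i = 0 then 1 else 0) - v $ i" for i
  define S where "S = (\<Sum>k<Suc n. w k * w k)"
  define c where "c = 2 / S"
  define W where "W = mat (Suc n) (Suc n) (\<lambda>(i, j). (if i = j then 1 else 0) - c * w i * w j)"
  have Sv: "(\<Sum>k<Suc n. v $ k * v $ k) = 1"
    using vv v by (simp add: scalar_prod_def atLeast0LessThan)
  \<comment> \<open>Only entry 0 of \<open>w\<close> differs from that of \<open>- v\<close>, which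
    accounts for the extra term; the squares of the entries of the unit vector \<open>v\<close> sum
    to 1.\<close>
  have "S = (\<Sum>k<Suc n. (if k = 0 then 1 - 2 * v $ 0 else 0) + v $ k * v $ k)"
    unfolding S_def by (intro sum.cong) (auto simp: w_def algebra_simps)
  also have "\<dots> = 2 * w 0"
    using Sv by (simp add: sum.distrib w_def del: sum.lessThan_Suc)
  finally have S: "S = 2 * w 0" .
  \<comment> \<open>Also true for \<open>S = 0\<close>, where \<open>c = 0\<close>.\<close>
  have cS: "c * c * S = 2 * c" by (simp add: c_def)
  have w0: "w k = 0" if "S = 0" "k < Suc n" for k
  proof -
    have "w k * w k = 0"
      using that sum_nonneg_eq_0_iff[of "{..<Suc n}" "\<lambda>k. w k * w k"] unfolding S_def by auto
    thus ?thesis by simp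
  qed
  \<comment> \<open>By \<open>S = 2 * w 0\<close>, the factor \<open>c * w 0\<close> is 1 unless
    \<open>S = 0\<close>, and then \<open>w\<close> vanishes. Hence column 0 of \<open>W\<close> is
    the first unit vector minus \<open>w\<close>, that is, \<open>v\<close>.\<close>
  have col: "c * w i * w 0 = w i" if "i < Suc n" for i
    using w0[OF _ that] S by (cases "S = 0") (auto simp: c_def)
  have W: "W \<in> carrier_mat (Suc n) (Suc n)" by (simp add: W_def)
  have "transpose_mat W * W = 1\<^sub>m (Suc n)"
  proof (rule eq_matI)
    fix i j assume "i < dim_row (1\<^sub>m (Suc n) :: real mat)" "j < dim_col (1\<^sub>m (Suc n) :: real mat)"
    hence ij: "i < Suc n" "j < Suc n" by auto
    have "(transpose_mat W * W) $$ (i, j) = (\<Sum>k<Suc n. W $$ (k, i) * W $$ (k, j))"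
      using ij W by (simp add: scalar_prod_def atLeast0LessThan)
    \<comment> \<open>The Kronecker deltas are sorted so that each sum collapses; by
      \<open>cS\<close> the quadratic term will cancel the two cross terms.\<close>
    also have "\<dots> = (\<Sum>k<Suc n. (if k = i then (if i = j then 1 else 0) - c * w i * w j else 0)
        - (if k = j then c * w i * w j else 0) + c * c * w i * w j * (w k * w k))"
      using ij by (intro sum.cong) (auto simp: W_def algebra_simps)
    also have "\<dots> = (if i = j then 1 else 0) - 2 * c * w i * w j + c * c * w i * w j * S"
      using ij unfolding S_def
      by (simp add: sum.distrib sum_subtractf sum_distrib_left del: sum.lessThan_Suc)
    also have "c * c * w i * w j * S = (c * c * S) * (w i * w j)" by simp
    also have "\<dots> = 2 * c * w i * w j" unfolding cS by simp
    finally show "(transpose_mat W * W) $$ (i, j) = 1\<^sub>m (Suc n) $$ (i, j)" using ij by simp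
  qed (use W in auto)
  moreover have "col W 0 = v"
  proof (rule eq_vecI)
    fix i assume "i < dim_vec v"
    hence "i < Suc n" using v by simp
    hence "col W 0 $ i = (if i = 0 then 1 else 0) - w i" using col[of i] by (simp add: W_def)
    thus "col W 0 $ i = v $ i" by (simp add: w_def)
  qed (use v W in auto)
  ultimately show thesis using that W by blast
qed

text \<open>Induction on the size, splitting off one eigenvector at a time. The factorization of the
  characteristic polynomial supplies a real eigenvalue at each stage, and taking the head of
  \<open>es\<close> makes the diagonal follow the order of the list.\<close>

lemma real_spectral:
  fixes A :: "real mat"
  assumes "A \<in> carrier_mat n n" "transpose_mat A = A" "char_poly A = (\<Prod>e\<leftarrow>es. [:- e, 1:])"
  shows "\<exists>P. P \<in> carrier_mat n n \<and> transpose_mat P * P = 1\<^sub>m n \<and>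
    transpose_mat P * A * P = mat_diag n (\<lambda>i. es ! i)"
  using assms
proof (induction n arbitrary: A es)
  case 0
  show ?case using 0 by (intro exI[of _ "1\<^sub>m 0"]) (auto intro!: eq_matI simp: mat_diag_def)
next
  case (Suc n)
  let ?N = "Suc n"
  note A = Suc.prems(1) and sym = Suc.prems(2) and cp = Suc.prems(3)
  note [simp] = mult_carrier_mat[of _ ?N ?N _ ?N]
  \<comment> \<open>The characteristic polynomial has degree \<open>Suc n\<close>, while an empty
    product is constant.\<close>
  have "es \<noteq> []" using cp degree_monic_char_poly[OF A] by auto
  then obtain e es' where es: "es = e # es'" by (cases es) auto
  have "eigenvalue A e" unfolding eigenvalue_root_char_poly[OF A] cp es by simp
  then obtain u where u: "u \<in> carrier_vec ?N" "u \<noteq> 0\<^sub>v ?N" "A *\<^sub>v u = e \<cdot>\<^sub>v u"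
    using A unfolding eigenvalue_def eigenvector_def by auto
  define v where "v = (1 / sqrt (u \<bullet> u)) \<cdot>\<^sub>v u"
  have "u \<bullet> u > 0" using u(1,2) conjugate_square_greater_0_vec[of u ?N] by simp
  hence vv: "v \<bullet> v = 1" and v: "v \<in> carrier_vec ?N"
    using u(1) by (auto simp: v_def)
  have Av: "A *\<^sub>v v = e \<cdot>\<^sub>v v"
    using A u unfolding v_def by (simp add: mult_mat_vec smult_smult_assoc mult.commute)
  obtain W where W: "W \<in> carrier_mat ?N ?N" and WW: "transpose_mat W * W = 1\<^sub>m ?N"
    and Wv: "col W 0 = v" using householder[OF v vv] .
  define B where "B = transpose_mat W * A * W"
  have B: "B \<in> carrier_mat ?N ?N" using W A by (simp add: B_def)
  have WW': "W * transpose_mat W = 1\<^sub>m ?N"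
    using WW W mat_mult_left_right_inverse[of "transpose_mat W" ?N W] by simp
  have symB: "transpose_mat B = B"
    unfolding B_def using W A sym by (simp add: transpose_mult[of _ ?N ?N _ ?N] assoc_mult_mat[of _ ?N ?N _ ?N _ ?N])
  \<comment> \<open>Column 0 of \<open>W\<close> is the eigenvector \<open>v\<close>, so column 0 of
    \<open>B\<close> is \<open>e\<close> times column 0 of
    \<open>transpose_mat W * W\<close>.\<close>
  have "B = transpose_mat W * (A * W)"
    unfolding B_def using W A by (intro assoc_mult_mat) auto
  hence "col B 0 = transpose_mat W *\<^sub>v col (A * W) 0"
    using col_mult2[of "transpose_mat W" ?N ?N "A * W" ?N 0] W A by (simp del: col_mult)
  also have "col (A * W) 0 = A *\<^sub>v col W 0"
    using W A by (intro col_mult2) auto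
  also have "transpose_mat W *\<^sub>v (A *\<^sub>v col W 0) = e \<cdot>\<^sub>v (transpose_mat W *\<^sub>v col W 0)"
    unfolding Wv Av using W v by (simp add: mult_mat_vec)
  also have "transpose_mat W *\<^sub>v col W 0 = col (transpose_mat W * W) 0"
    using W by (intro col_mult2[symmetric]) auto
  finally have colB: "col B 0 = e \<cdot>\<^sub>v unit_vec ?N 0" unfolding WW by simp
  have B0: "B $$ (i, 0) = (if i = 0 then e else 0)" if "i < ?N" for i
    using arg_cong[OF colB, of "\<lambda>x. x $ i"] that B by simp
  \<comment> \<open>Symmetry of \<open>B\<close> clears the first row as well, which gives the block
    form below.\<close>
  have B0': "B $$ (0, i) = (if i = 0 then e else 0)" if "i < ?N" for i
    using B0[OF that] that B arg_cong[OF symB, of "\<lambda>x. x $$ (i, 0)"] by simp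
  define C where "C = mat n n (\<lambda>(i, j). B $$ (Suc i, Suc j))"
  define E where "E = mat 1 1 (\<lambda>_. e)"
  have C: "C \<in> carrier_mat n n" and E: "E \<in> carrier_mat 1 1" by (auto simp: C_def E_def)
  have BC: "B = four_block_mat E (0\<^sub>m 1 n) (0\<^sub>m n 1) C"
    using B B0 B0' by (intro eq_matI) (auto simp: C_def E_def)
  have symC: "transpose_mat C = C"
  proof (rule eq_matI)
    fix i j assume "i < dim_row C" "j < dim_col C"
    thus "transpose_mat C $$ (i, j) = C $$ (i, j)"
      using B arg_cong[OF symB, of "\<lambda>x. x $$ (Suc i, Suc j)"] by (simp add: C_def)
  qed (auto simp: C_def)
  \<comment> \<open>For orthogonal \<open>W\<close> the congruence is also a similarity and keeps
    the characteristic polynomial; cancelling the factor of \<open>e\<close> leaves the splitting of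
    \<open>char_poly C\<close> that the induction hypothesis asks for.\<close>
  have "similar_mat B A"
    unfolding similar_mat_def similar_mat_wit_def using A B W WW WW'
    by (intro exI[of _ "transpose_mat W"] exI[of _ W]) (auto simp: B_def)
  hence "char_poly A = char_poly B" by (rule char_poly_similar[symmetric])
  also have "\<dots> = char_poly E * char_poly C"
    unfolding BC using E C by (intro char_poly_four_block_zeros_col) auto
  also have "char_poly E = [:- e, 1:]"
    by (simp add: E_def char_poly_defs det_def sign_def)
  finally have "char_poly C = (\<Prod>e\<leftarrow>es'. [:- e, 1:])"
    unfolding cp es by (simp del: mult_pCons_left)
  then obtain Q where Q: "Q \<in> carrier_mat n n" and QQ: "transpose_mat Q * Q = 1\<^sub>m n"
    and QC: "transpose_mat Q * C * Q = mat_diag n (\<lambda>i. es' ! i)"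
    using Suc.IH[OF C symC] by blast
  \<comment> \<open>\<open>R\<close> fixes the direction already split off and diagonalizes the
    remaining block.\<close>
  define R where "R = four_block_mat (1\<^sub>m 1) (0\<^sub>m 1 n) (0\<^sub>m n 1) Q"
  have R: "R \<in> carrier_mat ?N ?N" using four_block_carrier_mat[of "1\<^sub>m 1" 1 1 Q n n] Q by (simp add: R_def)
  have RT: "transpose_mat R = four_block_mat (1\<^sub>m 1) (0\<^sub>m 1 n) (0\<^sub>m n 1) (transpose_mat Q)"
    unfolding R_def using Q by (subst transpose_four_block_mat[of _ 1 1 _ n _ n]) auto
  have RR: "transpose_mat R * R = 1\<^sub>m ?N"
    unfolding RT unfolding R_def using Q QQ
    by (subst mult_four_block_mat[of _ 1 1 _ n _ n _ _ 1 _ n]) (auto simp: four_block_one_mat)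
  have RB: "transpose_mat R * B = four_block_mat E (0\<^sub>m 1 n) (0\<^sub>m n 1) (transpose_mat Q * C)"
    unfolding RT BC using Q E C
    by (subst mult_four_block_mat[of _ 1 1 _ n _ n _ _ 1 _ n]) auto
  have "transpose_mat R * B * R = four_block_mat E (0\<^sub>m 1 n) (0\<^sub>m n 1) (mat_diag n (\<lambda>i. es' ! i))"
    unfolding RB unfolding R_def using Q E C QC
    by (subst mult_four_block_mat[of _ 1 1 _ n _ n _ _ 1 _ n]) (auto simp: mult_carrier_mat[of _ n n _ n])
  also have "\<dots> = mat_diag ?N (\<lambda>i. es ! i)"
    by (rule eq_matI) (auto simp: E_def mat_diag_def es nth_Cons')
  finally have RBR: "transpose_mat R * B * R = mat_diag ?N (\<lambda>i. es ! i)" .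
  show ?case
  proof (intro exI[of _ "W * R"] conjI)
    show "W * R \<in> carrier_mat ?N ?N" using W R by simp
    show "transpose_mat (W * R) * (W * R) = 1\<^sub>m ?N"
      using congruence_mult[OF W R, of "1\<^sub>m ?N"] W R WW RR by simp
    show "transpose_mat (W * R) * A * (W * R) = mat_diag ?N (\<lambda>i. es ! i)"
      using congruence_mult[OF W R A] RBR unfolding B_def by simp
  qed
qed

section \<open>Eigenvalues with multiplicity and the reduction to \<open>G_pq\<close>\<close>

text \<open>The product of the linear factors divides the characteristic polynomial. With
  \<open>n\<close> roots the degrees agree, and both polynomials are monic, so the quotient is
  1.\<close>

lemma char_poly_eq_prod_eigenvalues:
  fixes A :: "real mat"
  assumes A: "A \<in> carrier_mat n n" and es: "mset es = eigenvalues_mset A" and "length es = n"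
  shows "char_poly A = (\<Prod>e\<leftarrow>es. [:- e, 1:])"
proof -
  let ?P = "\<lambda>es. \<Prod>e\<leftarrow>es. [:- e, 1::real:]"
  have dvd: "?P es dvd p" if "mset es \<subseteq># proots p" "p \<noteq> 0" for es and p :: "real poly"
    using that
  proof (induction es arbitrary: p)
    case (Cons e es)
    hence "e \<in># proots p" by (auto dest: mset_subset_eqD)
    hence "poly p e = 0" using Cons.prems by simp
    then obtain r where p: "p = [:- e, 1:] * r" by (auto simp: poly_eq_0_iff_dvd elim: dvdE)
    hence "r \<noteq> 0" using Cons.prems by auto
    \<comment> \<open>Dividing by one linear factor removes exactly one copy of \<open>e\<close>, so
      the induction hypothesis applies to the quotient \<open>r\<close>.\<close>
    hence "proots p = add_mset e (proots r)"
      unfolding p by (subst proots_mult) auto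
    hence "?P es dvd r" using Cons \<open>r \<noteq> 0\<close> by auto
    thus ?case unfolding p by (simp add: mult_dvd_mono del: mult_pCons_left)
  qed auto
  note cp = degree_monic_char_poly[OF A]
  hence "char_poly A \<noteq> 0" by auto
  hence "?P es dvd char_poly A" using dvd es unfolding eigenvalues_mset_def by auto
  then obtain r where r: "char_poly A = ?P es * r" by (elim dvdE)
  have P: "degree (?P es) = length es \<and> lead_coeff (?P es) = 1" for es
  proof (induction es)
    case (Cons e es)
    hence "?P es \<noteq> 0" by auto
    hence deg: "degree (?P (e # es)) = length (e # es)"
      using Cons by (simp add: degree_mult_eq del: mult_pCons_left)
    have "lead_coeff (?P (e # es)) = lead_coeff [:- e, 1:] * lead_coeff (?P es)"
      by (simp only: list.map prod_list.Cons lead_coeff_mult)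
    also have "\<dots> = 1" using Cons by auto
    finally show ?case using deg by blast
  qed auto
  have "r \<noteq> 0" "?P es \<noteq> 0" using r \<open>char_poly A \<noteq> 0\<close> by auto
  hence "degree r = 0"
    using degree_mult_eq[of "?P es" r] r cp P[of es] assms(3) by simp
  moreover have "lead_coeff r = 1"
    using lead_coeff_mult[of "?P es" r] r cp P[of es] by auto
  ultimately have "r = 1" by (metis degree_eq_zeroE lead_coeff_pCons(2) one_pCons)
  thus ?thesis using r by simp
qed

lemma size_eigenvalues_mset_le:
  assumes "A \<in> carrier_mat n n"
  shows "size (eigenvalues_mset A) \<le> n"
  using size_proots_le[of "char_poly A"] degree_monic_char_poly[OF assms]
  by (simp add: eigenvalues_mset_def)

lemma num_pos_eigenvalues_le:
  assumes "A \<in> carrier_mat n n"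
  shows "num_pos_eigenvalues A \<le> n"
  unfolding num_pos_eigenvalues_def
  using size_filter_mset_lesseq[of "\<lambda>x. 0 < x" "eigenvalues_mset A"] size_eigenvalues_mset_le[OF assms]
  by linarith

text \<open>Sylvester's normal form. The equation \<open>n = p + q\<close> ensures that the positive
  and negative roots are all the roots, counted up to the full degree, so the spectral lemma
  applies.\<close>

lemma congruent_to_G_pq:
  assumes A: "A \<in> carrier_mat n n" and sym: "transpose_mat A = A"
    and p: "p = num_pos_eigenvalues A" and q: "q = num_neg_eigenvalues A" and n: "n = p + q"
  shows "\<exists>D. D \<in> carrier_mat n n \<and> transpose_mat D * A * D = G_pq p q"
proof -
  note [simp] = mult_carrier_mat[of _ n n _ n]
  obtain ps ns where ps: "mset ps = filter_mset (\<lambda>x. 0 < x) (eigenvalues_mset A)"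
    and ns: "mset ns = filter_mset (\<lambda>x. x < 0) (eigenvalues_mset A)"
    using ex_mset by metis
  \<comment> \<open>Positive eigenvalues come first, so that the signs on the diagonal follow the
    order in \<open>G_pq\<close>.\<close>
  define es where "es = ps @ ns"
  have lp: "length ps = p" and ln: "length ns = q"
    using ps ns p q unfolding num_pos_eigenvalues_def num_neg_eigenvalues_def by (metis size_mset)+
  hence len: "length es = n" by (simp add: es_def n)
  have pos: "es ! i > 0" if "i < p" for i
    using that lp ps nth_mem_mset[of i ps] by (auto simp: es_def nth_append)
  have neg: "es ! i < 0" if "i < n" "\<not> i < p" for i
    using that lp ln n ns nth_mem_mset[of "i - p" ns] by (auto simp: es_def nth_append)
  have "mset es \<subseteq># eigenvalues_mset A"
    unfolding es_def mset_append ps ns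
    by (intro mset_subset_eqI) (auto simp: not_less)
  \<comment> \<open>A submultiset of size \<open>n\<close> of a multiset of size at most
    \<open>n\<close> is the whole of it.\<close>
  hence "mset es = eigenvalues_mset A"
    using size_eigenvalues_mset_le[OF A] len
    by (metis antisym_conv mset_subset_size not_less size_mset subset_mset.order_iff_strict)
  then obtain P where P: "P \<in> carrier_mat n n"
    and PA: "transpose_mat P * A * P = mat_diag n (\<lambda>i. es ! i)"
    using real_spectral[OF A sym char_poly_eq_prod_eigenvalues[OF A _ len]] by blast
  \<comment> \<open>Scaling the columns of \<open>P\<close> by these factors leaves only the signs
    of the eigenvalues.\<close>
  define S where "S = mat_diag n (\<lambda>i. 1 / sqrt \<bar>es ! i\<bar>)"
  have S: "S \<in> carrier_mat n n" by (simp add: S_def)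
  have ST: "transpose_mat S = S" by (rule eq_matI) (auto simp: S_def mat_diag_def)
  have "transpose_mat (P * S) * A * (P * S) = S * (transpose_mat P * A * P) * S"
    using congruence_mult[OF P S A] ST by simp
  also have "\<dots> = mat_diag n (\<lambda>i. 1 / sqrt \<bar>es ! i\<bar> * es ! i * (1 / sqrt \<bar>es ! i\<bar>))"
    unfolding PA S_def by simp
  also have "\<dots> = mat_diag n (\<lambda>i. if i < p then 1 else - 1)"
  proof -
    have "1 / sqrt \<bar>es ! i\<bar> * es ! i * (1 / sqrt \<bar>es ! i\<bar>) = (if i < p then 1 else - 1)"
      if "i < n" for i
      using pos[of i] neg[OF that] by (auto simp: field_simps)
    thus ?thesis unfolding mat_diag_def by (intro cong_mat) simp_all
  qed
  finally show ?thesis using P S n by (intro exI[of _ "P * S"]) (simp add: G_pq_def)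
qed


section \<open>Linear maps and the metric in bases of the fibres\<close>

text \<open>Stated for a bare real-valued function, so that it applies to the metric in either
  argument and to the metric composed with a linear map.\<close>

lemma linear_functional_finsum:
  fixes f :: "'e \<Rightarrow> real"
  assumes V: "vectorspace class_ring V"
    and lin: "\<And>u v a b. u \<in> carrier V \<Longrightarrow> v \<in> carrier V \<Longrightarrow>
      f ((a \<odot>\<^bsub>V\<^esub> u) \<oplus>\<^bsub>V\<^esub> (b \<odot>\<^bsub>V\<^esub> v)) = a * f u + b * f v"
    and "finite I" "\<And>i. i \<in> I \<Longrightarrow> w i \<in> carrier V"
  shows "f (\<Oplus>\<^bsub>V\<^esub> i \<in> I. c i \<odot>\<^bsub>V\<^esub> w i) = (\<Sum>i\<in>I. c i * f (w i))"
proof -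
  interpret vectorspace class_ring V by fact
  have one: "1 \<odot>\<^bsub>V\<^esub> x = x" if "x \<in> carrier V" for x
    using smult_one[OF that] by simp
  have cl: "a \<odot>\<^bsub>V\<^esub> x \<in> carrier V" if "x \<in> carrier V" for a x
    using smult_closed[OF _ that, of a] by simp
  have f0: "f \<zero>\<^bsub>V\<^esub> = 0"
    using lin[of "\<zero>\<^bsub>V\<^esub>" "\<zero>\<^bsub>V\<^esub>" 0 0] by simp
  show ?thesis using assms(3,4)
  proof (induction I)
    case empty
    show ?case using f0 by simp
  next
    case (insert i I)
    let ?s = "\<Oplus>\<^bsub>V\<^esub> i \<in> I. c i \<odot>\<^bsub>V\<^esub> w i"
    have s: "?s \<in> carrier V" using insert cl by (intro M.finsum_closed) auto
    have "(\<Oplus>\<^bsub>V\<^esub> i \<in> insert i I. c i \<odot>\<^bsub>V\<^esub> w i) = (c i \<odot>\<^bsub>V\<^esub> w i) \<oplus>\<^bsub>V\<^esub> (1 \<odot>\<^bsub>V\<^esub> ?s)"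
      using insert cl one[OF s] by (subst M.finsum_insert) auto
    also have "f \<dots> = c i * f (w i) + f ?s"
      using lin[of "w i" ?s "c i" 1] s insert.prems by auto
    finally show ?case using insert by simp
  qed
qed

lemma fibre_basis_carrier:
  assumes "vectorspace class_ring (fibre E x)" "fibre_basis n E x b" "i < n"
  shows "b i \<in> carrier (fibre E x)"
  using assms unfolding fibre_basis_def by (auto simp: vectorspace.basis_def)

lemma fibre_basis_expansion:
  assumes V: "vectorspace class_ring (fibre E x)" and b: "fibre_basis n E x b"
    and u: "u \<in> carrier (fibre E x)"
  obtains c where "u = (\<Oplus>\<^bsub>fibre E x\<^esub> i \<in> {..<n}. c i \<odot>\<^bsub>fibre E x\<^esub> b i)"
proof -
  let ?V = "fibre E x"
  interpret vectorspace class_ring ?V by fact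
  have inj: "inj_on b {..<n}" and gen: "span (b ` {..<n}) = carrier ?V"
    and sub: "b ` {..<n} \<subseteq> carrier ?V"
    using b unfolding fibre_basis_def basis_def by auto
  obtain a where "u = lincomb a (b ` {..<n})"
    using u gen finite_span[OF _ sub] by auto
  \<comment> \<open>\<open>lincomb\<close> sums over the set of basis vectors; injectivity of
    \<open>b\<close> allows reindexing by \<open>{..<n}\<close>.\<close>
  also have "\<dots> = (\<Oplus>\<^bsub>?V\<^esub> i \<in> {..<n}. a (b i) \<odot>\<^bsub>?V\<^esub> b i)"
    unfolding lincomb_def
    using sub inj by (subst M.finsum_reindex) (auto intro!: smult_closed)
  finally show thesis by (rule that[of "\<lambda>i. a (b i)"])
qed

lemma linear_functionals_eqI:
  fixes f h :: "'e \<Rightarrow> real"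
  assumes V: "vectorspace class_ring (fibre E x)" and b: "fibre_basis n E x b"
    and f: "\<And>u v a b. u \<in> carrier (fibre E x) \<Longrightarrow> v \<in> carrier (fibre E x) \<Longrightarrow>
      f ((a \<odot>\<^bsub>fibre E x\<^esub> u) \<oplus>\<^bsub>fibre E x\<^esub> (b \<odot>\<^bsub>fibre E x\<^esub> v)) = a * f u + b * f v"
    and h: "\<And>u v a b. u \<in> carrier (fibre E x) \<Longrightarrow> v \<in> carrier (fibre E x) \<Longrightarrow>
      h ((a \<odot>\<^bsub>fibre E x\<^esub> u) \<oplus>\<^bsub>fibre E x\<^esub> (b \<odot>\<^bsub>fibre E x\<^esub> v)) = a * h u + b * h v"
    and eq: "\<And>i. i < n \<Longrightarrow> f (b i) = h (b i)"
    and u: "u \<in> carrier (fibre E x)"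
  shows "f u = h u"
proof -
  obtain c where c: "u = (\<Oplus>\<^bsub>fibre E x\<^esub> i \<in> {..<n}. c i \<odot>\<^bsub>fibre E x\<^esub> b i)"
    using fibre_basis_expansion[OF V b u] .
  have bc: "b i \<in> carrier (fibre E x)" if "i \<in> {..<n}" for i
    using fibre_basis_carrier[OF V b] that by simp
  show ?thesis
    unfolding c
    using linear_functional_finsum[OF V f finite_lessThan bc, of n "\<lambda>i. i" c]
      linear_functional_finsum[OF V h finite_lessThan bc, of n "\<lambda>i. i" c] eq by simp
qed

lemma linear_map_combination:
  assumes "linear_map class_ring V W T" "u \<in> carrier V" "v \<in> carrier V"
  shows "T ((a \<odot>\<^bsub>V\<^esub> u) \<oplus>\<^bsub>V\<^esub> (b \<odot>\<^bsub>V\<^esub> v)) = (a \<odot>\<^bsub>W\<^esub> T u) \<oplus>\<^bsub>W\<^esub> (b \<odot>\<^bsub>W\<^esub> T v)"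
    and "T u \<in> carrier W"
proof -
  have V_module: "module class_ring V"
    using assms(1) by (simp add: linear_map_def vectorspace_def)
  interpret linear_map class_ring V W T by fact
  have "a \<odot>\<^bsub>V\<^esub> u \<in> carrier V" "b \<odot>\<^bsub>V\<^esub> v \<in> carrier V"
    using assms(2,3) Module.module.smult_closed[OF V_module] by auto
  thus "T ((a \<odot>\<^bsub>V\<^esub> u) \<oplus>\<^bsub>V\<^esub> (b \<odot>\<^bsub>V\<^esub> v)) = (a \<odot>\<^bsub>W\<^esub> T u) \<oplus>\<^bsub>W\<^esub> (b \<odot>\<^bsub>W\<^esub> T v)"
    using assms(2,3) by simp
  show "T u \<in> carrier W" using assms(2) by simp
qed

lemma matrix_of_map_image:
  assumes "matrix_of_map n W b b' T M" "j < n"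
  shows "T (b j) = (\<Oplus>\<^bsub>W\<^esub> i \<in> {..<n}. M $$ (i, j) \<odot>\<^bsub>W\<^esub> b' i)"
  using assms by (simp add: matrix_of_map_def)

section \<open>Metric matrices, isometries and composition of linear maps in bases\<close>

locale bundle_with_metric =
  fixes E :: "('e, 'b) vbundle" and n :: nat and g :: "'b \<Rightarrow> 'e \<Rightarrow> 'e \<Rightarrow> real"
  assumes vector_bundle: "real_vector_bundle n E" and metric: "bundle_metric E g"
begin

abbreviation "fib \<equiv> fibre E"
abbreviation "pts \<equiv> topspace (base_space E)"

lemma vs: "x \<in> pts \<Longrightarrow> vectorspace class_ring (fib x)"
  using vector_bundle unfolding real_vector_bundle_def by blast

lemma metric_linear:
  assumes "x \<in> pts" "u \<in> carrier (fib x)" "v \<in> carrier (fib x)" "w \<in> carrier (fib x)"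
  shows "g x ((a \<odot>\<^bsub>fib x\<^esub> u) \<oplus>\<^bsub>fib x\<^esub> (b \<odot>\<^bsub>fib x\<^esub> v)) w = a * g x u w + b * g x v w"
    and "g x w ((a \<odot>\<^bsub>fib x\<^esub> u) \<oplus>\<^bsub>fib x\<^esub> (b \<odot>\<^bsub>fib x\<^esub> v)) = a * g x w u + b * g x w v"
  using metric assms unfolding bundle_metric_def by blast+

lemma metric_sym:
  assumes "x \<in> pts" "u \<in> carrier (fib x)" "v \<in> carrier (fib x)"
  shows "g x u v = g x v u"
  using metric assms unfolding bundle_metric_def by blast

lemma metric_matrix_carrier: "metric_matrix n g x b \<in> carrier_mat n n"
  by (simp add: metric_matrix_def)

lemma metric_matrix_sym:
  assumes x: "x \<in> pts" and b: "fibre_basis n E x b"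
  shows "transpose_mat (metric_matrix n g x b) = metric_matrix n g x b"
  using metric_sym[OF x] fibre_basis_carrier[OF vs[OF x] b]
  by (intro eq_matI) (auto simp: metric_matrix_def)

text \<open>Column \<open>j\<close> of \<open>M\<close> holds the coordinates of
  \<open>T (b' j)\<close> in \<open>b\<close>; expanding the second argument of the metric gives the
  product.\<close>

lemma metric_matrix_mult:
  assumes x: "x \<in> pts" and b: "fibre_basis n E x b"
    and M: "matrix_of_map n (fib x) b' b T M" and i: "i < n" and j: "j < n"
  shows "(metric_matrix n g x b * M) $$ (i, j) = g x (b i) (T (b' j))"
proof -
  have bc: "b k \<in> carrier (fib x)" if "k < n" for k
    using fibre_basis_carrier[OF vs[OF x] b that] .
  have "g x (b i) (T (b' j)) = (\<Sum>k<n. M $$ (k, j) * g x (b i) (b k))"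
    unfolding matrix_of_map_image[OF M j]
    by (rule linear_functional_finsum[OF vs[OF x]]) (simp_all add: metric_linear(2)[OF x] bc i)
  also have "\<dots> = (metric_matrix n g x b * M) $$ (i, j)"
    using M i j unfolding matrix_of_map_def metric_matrix_def
    by (auto simp: scalar_prod_def atLeast0LessThan mult.commute intro!: sum.cong)
  finally show ?thesis by simp
qed

lemma metric_matrix_congruence:
  assumes x: "x \<in> pts" and b: "fibre_basis n E x b"
    and M: "matrix_of_map n (fib x) b' b T M" and i: "i < n" and j: "j < n"
    and Tj: "T (b' j) \<in> carrier (fib x)"
  shows "(transpose_mat M * metric_matrix n g x b * M) $$ (i, j) = g x (T (b' i)) (T (b' j))"
proof -
  have bc: "b k \<in> carrier (fib x)" if "k < n" for k
    using fibre_basis_carrier[OF vs[OF x] b that] .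
  have Mc: "M \<in> carrier_mat n n" using M by (simp add: matrix_of_map_def)
  have "g x (T (b' i)) (T (b' j)) = (\<Sum>k<n. M $$ (k, i) * g x (b k) (T (b' j)))"
    unfolding matrix_of_map_image[OF M i]
    by (rule linear_functional_finsum[OF vs[OF x], where f = "\<lambda>u. g x u (T (b' j))"])
      (simp_all add: metric_linear(1)[OF x] bc Tj)
  also have "\<dots> = (\<Sum>k<n. M $$ (k, i) * (metric_matrix n g x b * M) $$ (k, j))"
    using metric_matrix_mult[OF x b M _ j] by simp
  also have "\<dots> = (transpose_mat M * (metric_matrix n g x b * M)) $$ (i, j)"
    using Mc i j
    by (auto simp: scalar_prod_def atLeast0LessThan metric_matrix_def intro!: sum.cong)
  finally show ?thesis
    using Mc metric_matrix_carrier by (simp add: assoc_mult_mat[of _ n n _ n _ n])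
qed

text \<open>By \<open>metric_matrix_congruence\<close> the matrix identity is the isometry condition
  on pairs of basis vectors; linearity extends it to the fibre, one argument at a time.\<close>

lemma isometry_iff_congruence:
  assumes x: "x \<in> pts" and y: "y \<in> pts"
    and b: "fibre_basis n E x b" and b': "fibre_basis n E y b'"
    and T: "linear_map class_ring (fib x) (fib y) T"
    and M: "matrix_of_map n (fib y) b b' T M"
  shows "(\<forall>u \<in> carrier (fib x). \<forall>v \<in> carrier (fib x). g x u v = g y (T u) (T v)) \<longleftrightarrow>
    transpose_mat M * metric_matrix n g y b' * M = metric_matrix n g x b"
    (is "?L \<longleftrightarrow> ?R")
proof (rule iffI)
  have bc: "b k \<in> carrier (fib x)" if "k < n" for k
    using fibre_basis_carrier[OF vs[OF x] b that] .
  note T' = linear_map_combination[OF T]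
  have Tc: "T u \<in> carrier (fib y)" if "u \<in> carrier (fib x)" for u using T'(2) that by blast
  note MM = metric_matrix_congruence[OF y b' M _ _ Tc[OF bc]]
  have Mc: "M \<in> carrier_mat n n" using M by (simp add: matrix_of_map_def)
  show ?R if ?L
    using that MM bc Mc by (intro eq_matI) (auto simp: metric_matrix_def)
  show ?L if R: ?R
  proof -
    have *: "g x (b i) (b j) = g y (T (b i)) (T (b j))" if "i < n" "j < n" for i j
      using MM[OF that(1) that(2) that(2)] that unfolding R by (simp add: metric_matrix_def)
    \<comment> \<open>The first argument is freed here while the second stays in the basis; the
      second is freed next.\<close>
    have **: "g x u (b j) = g y (T u) (T (b j))" if "u \<in> carrier (fib x)" "j < n" for u j
      by (rule linear_functionals_eqI[OF vs[OF x] b, where f = "\<lambda>u. g x u (b j)"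
            and h = "\<lambda>u. g y (T u) (T (b j))"])
        (simp_all add: that bc * metric_linear(1)[OF x] metric_linear(1)[OF y] T' Tc)
    show ?L
    proof (intro ballI)
      fix u v assume u: "u \<in> carrier (fib x)" and v: "v \<in> carrier (fib x)"
      show "g x u v = g y (T u) (T v)"
        by (rule linear_functionals_eqI[OF vs[OF x] b, where f = "g x u"
              and h = "\<lambda>v. g y (T u) (T v)"])
          (simp_all add: u v ** metric_linear(2)[OF x] metric_linear(2)[OF y] T' Tc)
    qed
  qed
qed

text \<open>Pairing with the nondegenerate metric at the endpoint determines the coefficients in the
  basis there, so linear independence is not used.\<close>

lemma matrix_of_map_comp:
  assumes y: "y \<in> pts" and z: "z \<in> pts"
    and cy: "fibre_basis n E y cy" and bz: "fibre_basis n E z bz"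
    and nondeg: "det (metric_matrix n g z bz) \<noteq> 0"
    and T': "linear_map class_ring (fib y) (fib z) T'"
    and M: "matrix_of_map n (fib y) bx cy T M"
    and M': "matrix_of_map n (fib z) cy bz T' M'"
    and N: "matrix_of_map n (fib z) bx bz (\<lambda>u. T' (T u)) N"
  shows "M' * M = N"
proof -
  let ?G = "metric_matrix n g z bz"
  have carr: "M \<in> carrier_mat n n" "M' \<in> carrier_mat n n" "N \<in> carrier_mat n n"
    using M M' N by (auto simp: matrix_of_map_def)
  have yc: "cy k \<in> carrier (fib y)" if "k < n" for k
    using fibre_basis_carrier[OF vs[OF y] cy that] .
  have zc: "bz k \<in> carrier (fib z)" if "k < n" for k
    using fibre_basis_carrier[OF vs[OF z] bz that] .
  note lin = linear_map_combination[OF T']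
  have Tc: "T' u \<in> carrier (fib z)" if "u \<in> carrier (fib y)" for u using lin(2) that by blast
  \<comment> \<open>Both sides have the entries \<open>g z (bz i) (T' (T (bx j)))\<close>;
    afterwards \<open>?G\<close> is cancelled.\<close>
  have "?G * M' * M = ?G * N"
  proof (rule eq_matI)
    fix i j assume "i < dim_row (?G * N)" "j < dim_col (?G * N)"
    hence i: "i < n" and j: "j < n" using carr by (auto simp: metric_matrix_def)
    have "(?G * N) $$ (i, j) = g z (bz i) (T' (T (bx j)))"
      using metric_matrix_mult[OF z bz N i j] .
    also have "\<dots> = (\<Sum>k<n. M $$ (k, j) * g z (bz i) (T' (cy k)))"
      unfolding matrix_of_map_image[OF M j]
      by (rule linear_functional_finsum[OF vs[OF y], where f = "\<lambda>u. g z (bz i) (T' u)"])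
        (simp_all add: metric_linear(2)[OF z] yc zc i lin Tc)
    also have "\<dots> = (\<Sum>k<n. M $$ (k, j) * (?G * M') $$ (i, k))"
      using metric_matrix_mult[OF z bz M' i] by simp
    also have "\<dots> = (?G * M' * M) $$ (i, j)"
      using carr i j
      by (auto simp: scalar_prod_def atLeast0LessThan metric_matrix_def mult.commute intro!: sum.cong)
    finally show "(?G * M' * M) $$ (i, j) = (?G * N) $$ (i, j)" by simp
  qed (use carr in \<open>auto simp: metric_matrix_def\<close>)
  hence "mat_inv ?G * (?G * (M' * M)) = mat_inv ?G * (?G * N)"
    using carr metric_matrix_carrier by (simp add: assoc_mult_mat[of _ n n _ n _ n])
  hence "(mat_inv ?G * ?G) * (M' * M) = (mat_inv ?G * ?G) * N"
    using carr metric_matrix_carrier mat_inv_props(3)[OF metric_matrix_carrier nondeg]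
    by (simp add: assoc_mult_mat[of _ n n _ n _ n] mult_carrier_mat[of _ n n _ n])
  thus ?thesis
    using carr mat_inv_props(2)[OF metric_matrix_carrier nondeg] mult_carrier_mat[of M' n n M n]
    by simp
qed

end


section \<open>Consistency of transports with the metric\<close>

text \<open>Existence of \<open>D\<close> is asserted beside the equivalence, so that quantifying
  the latter over all such \<open>D\<close> is not vacuous. Only the congruence is asked of
  \<open>D\<close>: an orthogonal one keeps the eigenvalues and could reach \<open>G_pq\<close> only
  when those of \<open>G\<close> are all 1 or -1.\<close>

theorem proposition2p5:
  fixes E :: "('e, 'b) vbundle"
    and g :: "'b \<Rightarrow> 'e \<Rightarrow> 'e \<Rightarrow> real"
    and L :: "'b bpath \<Rightarrow> real \<Rightarrow> real \<Rightarrow> 'e \<Rightarrow> 'e"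
    and \<Gamma> :: "'b bpath set"
    and e :: "'b bpath \<Rightarrow> real \<Rightarrow> nat \<Rightarrow> 'e"
    and H :: "real \<Rightarrow> real \<Rightarrow> 'b bpath \<Rightarrow> real mat"
    and G :: "real \<Rightarrow> 'b bpath \<Rightarrow> real mat"
    and n :: nat and p q :: "'b bpath \<Rightarrow> nat"
  assumes vector_bundle: "real_vector_bundle n E"
    and metric: "bundle_metric E g"
    and transport: "linear_transport E L"
    and every_or_given:
      "\<Gamma> = paths_in (base_space E) \<or> (\<exists>\<gamma> \<in> paths_in (base_space E). \<Gamma> = {\<gamma>})"
    and signature: "\<forall>\<gamma> \<in> \<Gamma>. \<forall>s \<in> dom_of \<gamma>. \<forall>t \<in> dom_of \<gamma>.
      signature_at n E g (point_at \<gamma> s) = signature_at n E g (point_at \<gamma> t)"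
    and bases: "\<forall>\<gamma> \<in> \<Gamma>. \<forall>s \<in> dom_of \<gamma>. fibre_basis n E (point_at \<gamma> s) (e \<gamma> s)"
    and G_def: "\<forall>\<gamma> \<in> \<Gamma>. \<forall>s \<in> dom_of \<gamma>. G s \<gamma> = metric_matrix n g (point_at \<gamma> s) (e \<gamma> s)"
    and pq: "\<forall>\<gamma> \<in> \<Gamma>. \<forall>s \<in> dom_of \<gamma>. p \<gamma> = num_pos_eigenvalues (G s \<gamma>) \<and>
      q \<gamma> = n - p \<gamma> \<and> q \<gamma> = num_neg_eigenvalues (G s \<gamma>)"
    and first_pos: "\<forall>\<gamma> \<in> \<Gamma>. \<forall>s \<in> dom_of \<gamma>. first_eigenvalues_pos (p \<gamma>) (G s \<gamma>)"
    and H_def: "\<forall>\<gamma> \<in> \<Gamma>. \<forall>s \<in> dom_of \<gamma>. \<forall>t \<in> dom_of \<gamma>.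
      matrix_of_map n (fibre E (point_at \<gamma> t)) (e \<gamma> s) (e \<gamma> t) (L \<gamma> s t) (H t s \<gamma>)"
  shows
    "(\<exists>D. \<forall>\<gamma> \<in> \<Gamma>. \<forall>s \<in> dom_of \<gamma>. D s \<gamma> \<in> carrier_mat n n \<and>
        transpose_mat (D s \<gamma>) * G s \<gamma> * D s \<gamma> = G_pq (p \<gamma>) (q \<gamma>)) \<and>
     (\<forall>D. (\<forall>\<gamma> \<in> \<Gamma>. \<forall>s \<in> dom_of \<gamma>. D s \<gamma> \<in> carrier_mat n n \<and>
        transpose_mat (D s \<gamma>) * G s \<gamma> * D s \<gamma> = G_pq (p \<gamma>) (q \<gamma>)) \<longrightarrow>
      ((\<forall>\<gamma> \<in> \<Gamma>. consistent_along E g L \<gamma>) \<longleftrightarrow>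
       (\<exists>F Y Z. \<forall>\<gamma> \<in> \<Gamma>.
          (\<forall>s \<in> dom_of \<gamma>. F s \<gamma> \<in> nondegenerate_mats n) \<and>
          (\<forall>s \<in> dom_of \<gamma>. \<forall>t \<in> dom_of \<gamma>. H t s \<gamma> = mat_inv (F t \<gamma>) * F s \<gamma>) \<and>
          Y \<gamma> \<in> nondegenerate_mats n \<and>
          (\<forall>s \<in> dom_of \<gamma>. Z s \<gamma> \<in> pseudo_orthogonal (p \<gamma>) (q \<gamma>) \<and>
             F s \<gamma> = Y \<gamma> * Z s \<gamma> * mat_inv (D s \<gamma>)))))"
proof (intro conjI allI impI)
  interpret bundle_with_metric E n g by unfold_locales (fact vector_bundle, fact metric)
  have path: "\<gamma> \<in> paths_in (base_space E)" if "\<gamma> \<in> \<Gamma>" for \<gamma>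
    using every_or_given that by auto
  have dom_ne: "dom_of \<gamma> \<noteq> {}" if "\<gamma> \<in> \<Gamma>" for \<gamma>
    using path[OF that] unfolding paths_in_def by auto
  have pt: "point_at \<gamma> s \<in> topspace (base_space E)" if "\<gamma> \<in> \<Gamma>" "s \<in> dom_of \<gamma>" for \<gamma> s
    using path[OF that(1)] that(2) unfolding paths_in_def
    by (auto simp: continuous_map_def Pi_iff)
  have b: "fibre_basis n E (point_at \<gamma> s) (e \<gamma> s)" if "\<gamma> \<in> \<Gamma>" "s \<in> dom_of \<gamma>" for \<gamma> s
    using bases that by blast
  have Gm: "G s \<gamma> = metric_matrix n g (point_at \<gamma> s) (e \<gamma> s)"
    if "\<gamma> \<in> \<Gamma>" "s \<in> dom_of \<gamma>" for \<gamma> s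
    using G_def that by blast
  have Gc: "G s \<gamma> \<in> carrier_mat n n" if "\<gamma> \<in> \<Gamma>" "s \<in> dom_of \<gamma>" for \<gamma> s
    using Gm[OF that] metric_matrix_carrier by simp
  have lin: "linear_map class_ring (fib (point_at \<gamma> s)) (fib (point_at \<gamma> t)) (L \<gamma> s t)"
    if "\<gamma> \<in> \<Gamma>" "s \<in> dom_of \<gamma>" "t \<in> dom_of \<gamma>" for \<gamma> s t
    using transport path[OF that(1)] that unfolding linear_transport_def by blast
  have Lcomp: "L \<gamma> t r (L \<gamma> s t u) = L \<gamma> s r u"
    if "\<gamma> \<in> \<Gamma>" "r \<in> dom_of \<gamma>" "s \<in> dom_of \<gamma>" "t \<in> dom_of \<gamma>" "u \<in> carrier (fib (point_at \<gamma> s))"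
    for \<gamma> r s t u
    using transport path[OF that(1)] that unfolding linear_transport_def by blast
  have Hm: "matrix_of_map n (fib (point_at \<gamma> t)) (e \<gamma> s) (e \<gamma> t) (L \<gamma> s t) (H t s \<gamma>)"
    if "\<gamma> \<in> \<Gamma>" "s \<in> dom_of \<gamma>" "t \<in> dom_of \<gamma>" for \<gamma> s t
    using H_def that by blast
  have Hc: "H t s \<gamma> \<in> carrier_mat n n" if "\<gamma> \<in> \<Gamma>" "s \<in> dom_of \<gamma>" "t \<in> dom_of \<gamma>" for \<gamma> s t
    using Hm[OF that] by (simp add: matrix_of_map_def)
  \<comment> \<open>Subtraction of naturals is truncated, so \<open>q = n - p\<close> yields the sum
    only together with \<open>p \<le> n\<close>.\<close>
  have n: "n = p \<gamma> + q \<gamma>" if "\<gamma> \<in> \<Gamma>" for \<gamma>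
  proof -
    obtain s where s: "s \<in> dom_of \<gamma>" using dom_ne[OF \<open>\<gamma> \<in> \<Gamma>\<close>] by blast
    have "p \<gamma> \<le> n"
      using pq that s num_pos_eigenvalues_le[OF Gc[OF that s]] by simp
    moreover have "q \<gamma> = n - p \<gamma>" using pq that s by blast
    ultimately show ?thesis by simp
  qed
  \<comment> \<open>Consistency becomes a statement about \<open>H\<close> and \<open>G\<close>
    alone, by the isometry criterion at each pair of parameters.\<close>
  have cons_iff: "consistent_along E g L \<gamma> \<longleftrightarrow>
      (\<forall>s \<in> dom_of \<gamma>. \<forall>t \<in> dom_of \<gamma>. transpose_mat (H t s \<gamma>) * G t \<gamma> * H t s \<gamma> = G s \<gamma>)"
    if "\<gamma> \<in> \<Gamma>" for \<gamma>
    unfolding consistent_along_def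
    by (intro ball_cong refl)
      (simp add: isometry_iff_congruence[OF pt pt b b lin Hm] Gm that)

  \<comment> \<open>The counts in \<open>pq\<close> hold at every parameter, so one
    \<open>G_pq\<close> serves the whole path.\<close>
  have "\<exists>M. M \<in> carrier_mat n n \<and> transpose_mat M * G s \<gamma> * M = G_pq (p \<gamma>) (q \<gamma>)"
    if "\<gamma> \<in> \<Gamma>" "s \<in> dom_of \<gamma>" for \<gamma> s
    using that pq n metric_matrix_sym[OF pt b]
    by (intro congruent_to_G_pq Gc) (simp_all add: Gm)
  thus "\<exists>D. \<forall>\<gamma> \<in> \<Gamma>. \<forall>s \<in> dom_of \<gamma>. D s \<gamma> \<in> carrier_mat n n \<and>
      transpose_mat (D s \<gamma>) * G s \<gamma> * D s \<gamma> = G_pq (p \<gamma>) (q \<gamma>)"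
    by (intro exI[of _ "\<lambda>s \<gamma>. SOME M. M \<in> carrier_mat n n \<and>
          transpose_mat M * G s \<gamma> * M = G_pq (p \<gamma>) (q \<gamma>)"] ballI) (rule someI_ex)

  fix D
  assume D_all: "\<forall>\<gamma> \<in> \<Gamma>. \<forall>s \<in> dom_of \<gamma>. D s \<gamma> \<in> carrier_mat n n \<and>
    transpose_mat (D s \<gamma>) * G s \<gamma> * D s \<gamma> = G_pq (p \<gamma>) (q \<gamma>)"
  have Dc: "D s \<gamma> \<in> carrier_mat n n"
    and DG: "transpose_mat (D s \<gamma>) * G s \<gamma> * D s \<gamma> = G_pq (p \<gamma>) (q \<gamma>)"
    if "\<gamma> \<in> \<Gamma>" "s \<in> dom_of \<gamma>" for \<gamma> s
    using D_all that by blast+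
  have Kc: "G_pq (p \<gamma>) (q \<gamma>) \<in> carrier_mat n n" if "\<gamma> \<in> \<Gamma>" for \<gamma>
    using G_pq_carrier n[OF that] by simp
  have po: "Z \<in> pseudo_orthogonal (p \<gamma>) (q \<gamma>) \<longleftrightarrow>
      Z \<in> carrier_mat n n \<and> transpose_mat Z * G_pq (p \<gamma>) (q \<gamma>) * Z = G_pq (p \<gamma>) (q \<gamma>)"
    if "\<gamma> \<in> \<Gamma>" for Z \<gamma>
    using n[OF that] by (auto simp: pseudo_orthogonal_def)
  \<comment> \<open>The composition law of \<open>L\<close> in matrix form, used for the converse
    direction.\<close>
  have HH: "H r t \<gamma> * H t s \<gamma> = H r s \<gamma>"
    if \<gamma>: "\<gamma> \<in> \<Gamma>" and rst: "r \<in> dom_of \<gamma>" "s \<in> dom_of \<gamma>" "t \<in> dom_of \<gamma>" for \<gamma> r s t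
  proof (rule matrix_of_map_comp[OF pt pt b b _ lin Hm Hm])
    \<comment> \<open>Nondegenerate because \<open>D\<close> carries this matrix to
      \<open>G_pq\<close>.\<close>
    show "det (metric_matrix n g (point_at \<gamma> r) (e \<gamma> r)) \<noteq> 0"
      using det_nonzero_of_congruence(2)[OF Dc Gc] DG Gm det_G_pq_nonzero \<gamma> rst by metis
    have "e \<gamma> s j \<in> carrier (fib (point_at \<gamma> s))" if "j < n" for j
      using fibre_basis_carrier[OF vs[OF pt] b that] \<gamma> rst by blast
    thus "matrix_of_map n (fib (point_at \<gamma> r)) (e \<gamma> s) (e \<gamma> r) (\<lambda>u. L \<gamma> t r (L \<gamma> s t u)) (H r s \<gamma>)"
      using Hm[OF \<gamma> rst(2,1)] Lcomp[OF \<gamma> rst] unfolding matrix_of_map_def by simp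
  qed (use \<gamma> rst in auto)

  let ?fact = "\<lambda>F Y Z. \<forall>\<gamma> \<in> \<Gamma>.
    (\<forall>s \<in> dom_of \<gamma>. F s \<gamma> \<in> nondegenerate_mats n) \<and>
    (\<forall>s \<in> dom_of \<gamma>. \<forall>t \<in> dom_of \<gamma>. H t s \<gamma> = mat_inv (F t \<gamma>) * F s \<gamma>) \<and>
    Y \<gamma> \<in> nondegenerate_mats n \<and>
    (\<forall>s \<in> dom_of \<gamma>. Z s \<gamma> \<in> pseudo_orthogonal (p \<gamma>) (q \<gamma>) \<and>
       F s \<gamma> = Y \<gamma> * Z s \<gamma> * mat_inv (D s \<gamma>))"
  show "(\<forall>\<gamma> \<in> \<Gamma>. consistent_along E g L \<gamma>) \<longleftrightarrow> (\<exists>F Y Z. ?fact F Y Z)"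
  proof
    assume cons: "\<forall>\<gamma> \<in> \<Gamma>. consistent_along E g L \<gamma>"
    \<comment> \<open>One base point per path, chosen from its nonempty domain.\<close>
    define s0 where "s0 \<gamma> = (SOME s. s \<in> dom_of \<gamma>)" for \<gamma> :: "'b bpath"
    define F where "F s \<gamma> = mat_inv (D (s0 \<gamma>) \<gamma>) * H (s0 \<gamma>) s \<gamma>" for s \<gamma>
    have "?fact F (\<lambda>\<gamma>. 1\<^sub>m n) (\<lambda>s \<gamma>. F s \<gamma> * D s \<gamma>)"
    proof (rule ballI)
      fix \<gamma> assume \<gamma>: "\<gamma> \<in> \<Gamma>"
      have s0: "s0 \<gamma> \<in> dom_of \<gamma>" using dom_ne[OF \<gamma>] unfolding s0_def by (simp add: some_in_eq)
      have HG: "transpose_mat (H t s \<gamma>) * G t \<gamma> * H t s \<gamma> = G s \<gamma>"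
        if "s \<in> dom_of \<gamma>" "t \<in> dom_of \<gamma>" for s t
        using cons cons_iff[OF \<gamma>] \<gamma> that by blast
      note fct = isometry_imp_transport_factorization[where J = "dom_of \<gamma>" and D = "\<lambda>s. D s \<gamma>"
          and G = "\<lambda>s. G s \<gamma>" and H = "\<lambda>t s. H t s \<gamma>",
          OF s0 Dc[OF \<gamma>] Gc[OF \<gamma>] Hc[OF \<gamma>] DG[OF \<gamma>] Kc[OF \<gamma>] det_G_pq_nonzero HH[OF \<gamma>] HG]
      show "(\<forall>s \<in> dom_of \<gamma>. F s \<gamma> \<in> nondegenerate_mats n) \<and>
        (\<forall>s \<in> dom_of \<gamma>. \<forall>t \<in> dom_of \<gamma>. H t s \<gamma> = mat_inv (F t \<gamma>) * F s \<gamma>) \<and>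
        1\<^sub>m n \<in> nondegenerate_mats n \<and>
        (\<forall>s \<in> dom_of \<gamma>. F s \<gamma> * D s \<gamma> \<in> pseudo_orthogonal (p \<gamma>) (q \<gamma>) \<and>
           F s \<gamma> = 1\<^sub>m n * (F s \<gamma> * D s \<gamma>) * mat_inv (D s \<gamma>))"
        unfolding F_def po[OF \<gamma>]
      proof (intro conjI ballI)
        show "1\<^sub>m n \<in> nondegenerate_mats n" by (simp add: nondegenerate_mats_iff)
      qed (rule fct; assumption)+
    qed
    thus "\<exists>F Y Z. ?fact F Y Z" by (intro exI)
  next
    assume "\<exists>F Y Z. ?fact F Y Z"
    then obtain F Y Z where fct: "?fact F Y Z" by blast
    show "\<forall>\<gamma> \<in> \<Gamma>. consistent_along E g L \<gamma>"
    proof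
      fix \<gamma> assume \<gamma>: "\<gamma> \<in> \<Gamma>"
      have "transpose_mat (H t s \<gamma>) * G t \<gamma> * H t s \<gamma> = G s \<gamma>"
        if st: "s \<in> dom_of \<gamma>" "t \<in> dom_of \<gamma>" for s t
        using \<gamma> st fct[rule_format, OF \<gamma>] po[OF \<gamma>] det_G_pq_nonzero
        by (intro transport_factorization_imp_isometry[where D = "\<lambda>s. D s \<gamma>"
              and G = "\<lambda>s. G s \<gamma>" and F = "\<lambda>s. F s \<gamma>" and Z = "\<lambda>s. Z s \<gamma>" and Y = "Y \<gamma>",
              OF Dc Dc Gc Gc DG DG Kc]) blast+
      thus "consistent_along E g L \<gamma>" using cons_iff[OF \<gamma>] by blast
    qed
  qed
qed

end
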